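(* Let $n$ be a positive integer. Then $$N_n = \sum_{d\mid n} A_{n/d},$$ where the sum runs over all positive divisors $d$ of $n$. In particular, for a prime $p$, $N_p = A_p + 1$.
   Context: $\mathbb{N}$ is the set of nonnegative integers. A numerical semigroup is a subset $S\subseteq\mathbb{N}$ that contains $0$, is closed under addition, and has finite complement in $\mathbb{N}$. Every numerical semigroup $S$ has a unique minimal generating set, which is finite; it is denoted $P(S)$ and its elements are called primitives. For $S\neq\mathbb{N}$ the Frobenius number $F(S)$ is the largest element of $\mathbb{N}\setminus S$; by convention $F(\mathbb{N})=-1$. For a positive integer $n$, $A_n$ denotes the number of numerical semigroups $S$ with $\max P(S)=n$, and $N_n$ denotes the number of numerical semigroups $S$ with $F(S)=n$. *)

theory Defs
  imports "HOL-Computational_Algebra.Primes"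
begin

definition numerical_semigroup :: "nat set \<Rightarrow> bool" where
  "numerical_semigroup S \<longleftrightarrow>
     0 \<in> S \<and> (\<forall>x\<in>S. \<forall>y\<in>S. x + y \<in> S) \<and> finite (UNIV - S)"

inductive_set submonoid_gen :: "nat set \<Rightarrow> nat set" for B :: "nat set" where
  zero: "0 \<in> submonoid_gen B"
| incl: "x \<in> B \<Longrightarrow> x \<in> submonoid_gen B"
| add: "x \<in> submonoid_gen B \<Longrightarrow> y \<in> submonoid_gen B \<Longrightarrow> x + y \<in> submonoid_gen B"

definition minimal_generating_set :: "nat set \<Rightarrow> nat set \<Rightarrow> bool" where
  "minimal_generating_set S B \<longleftrightarrow>
     submonoid_gen B = S \<and> (\<forall>C. C \<subset> B \<longrightarrow> submonoid_gen C \<noteq> S)"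

text \<open>The description in \<open>primitives\<close> is proper for numerical semigroups; see
  \<open>ex1_minimal_generating_set\<close> below. By \<open>finite_primitives\<close> and
  \<open>primitives_nonempty\<close>, so is the use of \<open>Max\<close> in
  \<open>num_max_primitive\<close>.\<close>

definition primitives :: "nat set \<Rightarrow> nat set" where
  "primitives S = (THE B. minimal_generating_set S B)"

definition frobenius_number :: "nat set \<Rightarrow> int" where
  "frobenius_number S = (if S = UNIV then -1 else int (Max (UNIV - S)))"

definition num_max_primitive :: "nat \<Rightarrow> nat" where
  "num_max_primitive n = card {S. numerical_semigroup S \<and> Max (primitives S) = n}"

definition num_frobenius :: "nat \<Rightarrow> nat" where
  "num_frobenius n = card {S. numerical_semigroup S \<and> frobenius_number S = int n}"

lemma ex1_minimal_generating_set:
  assumes "numerical_semigroup S"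
  shows "\<exists>!B. minimal_generating_set S B"
proof -
  define G where "G = {x\<in>S. x \<noteq> 0 \<and> \<not> (\<exists>a\<in>S. \<exists>b\<in>S. a \<noteq> 0 \<and> b \<noteq> 0 \<and> x = a + b)}"
  have S0: "0 \<in> S" and Sadd: "\<And>x y. x \<in> S \<Longrightarrow> y \<in> S \<Longrightarrow> x + y \<in> S"
    using assms by (auto simp: numerical_semigroup_def)
  have sub: "G \<subseteq> B" if B: "submonoid_gen B = S" for B
  proof
    fix x assume x: "x \<in> G"
    then have "x \<in> submonoid_gen B" using B by (auto simp: G_def)
    then show "x \<in> B" using x
    proof (induction rule: submonoid_gen.induct)
      case (add x y)
      then show ?case using B by (cases "x = 0"; cases "y = 0") (auto simp: G_def)
    qed (auto simp: G_def)
  qed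
  have "x \<in> S" if "x \<in> submonoid_gen G" for x
    using that by induction (auto simp: S0 Sadd, auto simp: G_def)
  moreover have "x \<in> S \<Longrightarrow> x \<in> submonoid_gen G" for x
  proof (induction x rule: less_induct)
    case (less x)
    show ?case
    proof (cases "x = 0 \<or> x \<in> G")
      case True
      then show ?thesis by (auto intro: submonoid_gen.intros)
    next
      case False
      then obtain a b where ab: "a \<in> S" "b \<in> S" "a \<noteq> 0" "b \<noteq> 0" "x = a + b"
        using less.prems by (auto simp: G_def)
      then show ?thesis using less.IH[of a] less.IH[of b] by (auto intro: submonoid_gen.add)
    qed
  qed
  ultimately have gen: "submonoid_gen G = S" by auto
  show ?thesis
  proof
    show "minimal_generating_set S G"
      unfolding minimal_generating_set_def using gen sub by blast
  next
    fix B assume "minimal_generating_set S B"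
    then show "B = G"
      unfolding minimal_generating_set_def using gen sub by blast
  qed
qed

lemma minimal_generating_set_primitives:
  assumes "numerical_semigroup S"
  shows "minimal_generating_set S (primitives S)"
  unfolding primitives_def by (rule theI') (rule ex1_minimal_generating_set[OF assms])

lemma finite_primitives:
  assumes "numerical_semigroup S"
  shows "finite (primitives S)"
proof -
  let ?P = "primitives S"
  have gen: "submonoid_gen ?P = S" and min: "\<And>C. C \<subset> ?P \<Longrightarrow> submonoid_gen C \<noteq> S"
    using minimal_generating_set_primitives[OF assms] by (auto simp: minimal_generating_set_def)
  have "finite (UNIV - S)" using assms by (simp add: numerical_semigroup_def)
  then obtain M where "\<And>x. x \<in> UNIV - S \<Longrightarrow> x \<le> M" by (meson finite_nat_set_iff_bounded_le)
  then have M: "\<And>x. M < x \<Longrightarrow> x \<in> S" by (meson DiffI UNIV_I leD)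
  let ?C = "{x\<in>?P. x \<le> 2 * M + 1}"
  have small: "x \<in> submonoid_gen ?C" if "x \<in> submonoid_gen ?P" "x \<le> 2 * M + 1" for x
    using that
  proof (induction rule: submonoid_gen.induct)
    case (add x y)
    then show ?case by (auto intro: submonoid_gen.add)
  qed (auto intro: submonoid_gen.intros)
  have "x \<in> S \<Longrightarrow> x \<in> submonoid_gen ?C" for x
  proof (induction x rule: less_induct)
    case (less x)
    show ?case
    proof (cases "x \<le> 2 * M + 1")
      case True
      then show ?thesis using less.prems gen small by blast
    next
      case False
      then have "M + 1 \<in> submonoid_gen ?C" "x - (M + 1) \<in> submonoid_gen ?C"
        using M less.IH by auto
      from submonoid_gen.add[OF this] False show ?thesis by simp
    qed
  qed
  moreover have "x \<in> submonoid_gen ?P" if "x \<in> submonoid_gen ?C" for x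
    using that by induction (auto intro: submonoid_gen.intros)
  ultimately have "submonoid_gen ?C = S" using gen by blast
  then have "?C = ?P" using min[of ?C] by blast
  then have "?P \<subseteq> {..2 * M + 1}" by blast
  then show ?thesis by (rule finite_subset) simp
qed

lemma primitives_nonempty:
  assumes "numerical_semigroup S"
  shows "primitives S \<noteq> {}"
proof
  assume "primitives S = {}"
  then have gen: "submonoid_gen {} = S"
    using minimal_generating_set_primitives[OF assms] by (simp add: minimal_generating_set_def)
  have "x = 0" if "x \<in> submonoid_gen {}" for x
    using that by induction auto
  then have "UNIV \<subseteq> (UNIV - S) \<union> {0}" using gen by blast
  moreover have "finite ((UNIV - S) \<union> {0})" using assms by (simp add: numerical_semigroup_def)
  ultimately have "finite (UNIV :: nat set)" by (rule finite_subset)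
  then show False by simp
qed

end

(* Both sides count traces below n. A numerical semigroup S with Frobenius number n is determined by
   T = S \<inter> {0..<n}, and the sets T that occur are those containing 0 and closed under all sums
   that are at most n (so that n itself is not such a sum). The same sets T correspond to the
   submonoids of the naturals with largest primitive n, via T \<mapsto> \<langle>T, n\<rangle>. Such a submonoid is cofinite
   iff its gcd is 1; in general its gcd is a divisor d of n, and dividing by d gives a numerical
   semigroup with largest primitive n / d. *)
theory Submission
  imports Defs
begin

text \<open>Since \<open>T \<subseteq> {..<n}\<close>, closure under sums up to and including \<open>n\<close> also says that \<open>n\<close> is not a
  sum of two elements of \<open>T\<close>.\<close>

definition truncated_semigroups :: "nat \<Rightarrow> nat set set" where
  "truncated_semigroups n =
     {T. T \<subseteq> {..<n} \<and> 0 \<in> T \<and> (\<forall>x\<in>T. \<forall>y\<in>T. x + y \<le> n \<longrightarrow> x + y \<in> T)}"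

lemma finite_truncated_semigroups: "finite (truncated_semigroups n)"
  by (rule finite_subset[of _ "Pow {..<n}"]) (auto simp: truncated_semigroups_def)

section \<open>Generators and primitives\<close>

lemma submonoid_gen_mult:
  assumes "x \<in> submonoid_gen B"
  shows "k * x \<in> submonoid_gen B"
  using assms by (induction k) (auto intro: submonoid_gen.intros)

lemma submonoid_gen_subset:
  assumes "numerical_semigroup S" "B \<subseteq> S"
  shows "submonoid_gen B \<subseteq> S"
proof
  fix x assume "x \<in> submonoid_gen B"
  then show "x \<in> S"
    by induction (use assms in \<open>auto simp: numerical_semigroup_def\<close>)
qed

lemma dvd_submonoid_gen:
  assumes "x \<in> submonoid_gen B" "\<And>b. b \<in> B \<Longrightarrow> d dvd b"
  shows "d dvd x"
  using assms by induction auto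

text \<open>Any use of \<open>add\<close> that yields such an \<open>x\<close> has a zero summand,
  so \<open>x\<close> must enter through \<open>incl\<close>.\<close>

lemma irreducible_in_generators:
  assumes "x \<in> submonoid_gen B" "x \<noteq> 0"
    and "\<And>a b. a \<in> submonoid_gen B \<Longrightarrow> b \<in> submonoid_gen B \<Longrightarrow> a \<noteq> 0 \<Longrightarrow> b \<noteq> 0 \<Longrightarrow> x \<noteq> a + b"
  shows "x \<in> B"
  using assms
proof (induction rule: submonoid_gen.induct)
  case (add x y)
  then show ?case by (cases "x = 0"; cases "y = 0") auto
qed auto

text \<open>Irreducible elements lie in every generating set and, by strong induction, generate
  \<open>S\<close>; minimality then forces equality. This replaces the definite description by a
  membership test.\<close>

lemma primitives_eq:
  assumes "numerical_semigroup S"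
  shows "primitives S = {x \<in> S. x \<noteq> 0 \<and> (\<forall>a\<in>S. \<forall>b\<in>S. a \<noteq> 0 \<longrightarrow> b \<noteq> 0 \<longrightarrow> x \<noteq> a + b)}"
    (is "_ = ?G")
proof -
  have gen: "submonoid_gen (primitives S) = S"
    and min: "\<And>C. C \<subset> primitives S \<Longrightarrow> submonoid_gen C \<noteq> S"
    using minimal_generating_set_primitives[OF assms] by (auto simp: minimal_generating_set_def)
  have sub: "?G \<subseteq> primitives S"
  proof
    fix x assume "x \<in> ?G"
    then show "x \<in> primitives S"
      using irreducible_in_generators[of x "primitives S"] unfolding gen by blast
  qed
  have "x \<in> submonoid_gen ?G" if "x \<in> S" for x
    using that
  proof (induction x rule: less_induct)
    case (less x)
    show ?case
    proof (cases "x = 0 \<or> x \<in> ?G")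
      case True
      then show ?thesis by (auto intro: submonoid_gen.intros)
    next
      case False
      then obtain a b where "a \<in> S" "b \<in> S" "a \<noteq> 0" "b \<noteq> 0" "x = a + b"
        using less.prems by auto
      then show ?thesis using less.IH[of a] less.IH[of b] by (auto intro: submonoid_gen.add)
    qed
  qed
  then have "submonoid_gen ?G = S"
    using submonoid_gen_subset[OF assms, of ?G] by auto
  with min[of ?G] sub show ?thesis by blast
qed

lemma Max_primitives_eq_iff:
  assumes "numerical_semigroup S"
  shows "Max (primitives S) = n \<longleftrightarrow> n \<in> primitives S \<and> (\<forall>x\<in>primitives S. x \<le> n)"
  by (subst Max_eq_iff) (use finite_primitives[OF assms] primitives_nonempty[OF assms] in auto)

section \<open>Gcd 1 and cofiniteness\<close>

text \<open>The least positive difference \<open>k\<close> of two elements of the submonoid divides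
  every generator, hence is 1.\<close>

lemma consecutive_in_submonoid_gen:
  assumes "Gcd B = 1"
  obtains x where "x \<in> submonoid_gen B" "Suc x \<in> submonoid_gen B"
proof -
  let ?M = "submonoid_gen B"
  let ?P = "\<lambda>k. k > 0 \<and> (\<exists>x\<in>?M. x + k \<in> ?M)"
  obtain b where "b \<in> B" "b \<noteq> 0"
    using assms by (metis Gcd_0_iff empty_iff insert_iff one_neq_zero subsetI)
  then have ex: "?P b" by (auto intro!: bexI[of _ 0] submonoid_gen.intros)
  define k where "k = (LEAST k. ?P k)"
  have "?P k" unfolding k_def using ex by (rule LeastI)
  then obtain x where k: "k > 0" and x: "x \<in> ?M" "x + k \<in> ?M" by blast
  have "k dvd m" if "m \<in> B" for m
  proof -
    \<comment> \<open>The elements \<open>?q * x + m\<close> and \<open>?q * (x + k)\<close> differ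
      by \<open>?r < k\<close>, so minimality of \<open>k\<close> leaves only
      \<open>?r = 0\<close>.\<close>
    let ?q = "m div k" and ?r = "m mod k"
    have "?q * (x + k) \<in> ?M" using x(2) by (rule submonoid_gen_mult)
    moreover have "?q * x + m \<in> ?M"
      using submonoid_gen_mult[OF x(1)] that by (auto intro: submonoid_gen.intros)
    moreover have "?q * x + m = ?q * (x + k) + ?r"
      by (simp add: algebra_simps)
    ultimately have "?r = 0 \<or> ?P ?r" by auto
    moreover have "\<not> ?P ?r"
      unfolding k_def by (rule not_less_Least) (use k in \<open>simp flip: k_def\<close>)
    ultimately show ?thesis by blast
  qed
  then have "k dvd Gcd B" by (rule Gcd_greatest)
  then have "k = 1" using assms by simp
  then show ?thesis using that x by auto
qed

text \<open>With \<open>x\<close> and \<open>Suc x\<close> available, \<open>n = q * x + r\<close>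
  with \<open>r \<le> q\<close> equals \<open>r * Suc x + (q - r) * x\<close>.\<close>

lemma numerical_semigroup_submonoid_gen:
  assumes "Gcd B = 1"
  shows "numerical_semigroup (submonoid_gen B)"
proof -
  let ?M = "submonoid_gen B"
  obtain x where x: "x \<in> ?M" "Suc x \<in> ?M"
    using consecutive_in_submonoid_gen[OF assms] .
  have "n \<in> ?M" if n: "n \<ge> x * x" for n
  proof (cases "x = 0")
    case True
    then show ?thesis using submonoid_gen_mult[OF x(2), of n] by simp
  next
    case False
    \<comment> \<open>The bound \<open>x * x\<close> makes the quotient at least \<open>x\<close>,
      hence larger than the remainder.\<close>
    have "n mod x \<le> n div x"
      using n False by (meson div_greater_zero_iff div_le_mono less_imp_le_nat less_le_trans
          less_eq_div_iff_mult_less_eq mod_less_divisor not_gr_zero)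
    then obtain s where s: "n div x = n mod x + s" using le_Suc_ex by blast
    have "n = n div x * x + n mod x" by simp
    also have "\<dots> = (n mod x) * Suc x + s * x" by (simp only: s) (simp add: algebra_simps)
    finally show ?thesis
      using submonoid_gen.add submonoid_gen_mult x by metis
  qed
  then have "UNIV - ?M \<subseteq> {..<x * x}" by (auto simp: not_le[symmetric])
  then have "finite (UNIV - ?M)" by (rule finite_subset) simp
  then show ?thesis
    by (auto simp: numerical_semigroup_def intro: submonoid_gen.intros)
qed

text \<open>Beyond the last gap there are two consecutive elements, and \<open>Gcd B\<close> divides
  both.\<close>

lemma Gcd_generators_numerical_semigroup:
  assumes "numerical_semigroup (submonoid_gen B)"
  shows "Gcd B = 1"
proof -
  obtain M where "\<forall>x \<in> UNIV - submonoid_gen B. x \<le> M"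
    using assms by (auto simp: numerical_semigroup_def finite_nat_set_iff_bounded_le)
  then have "Suc M \<in> submonoid_gen B" "Suc (Suc M) \<in> submonoid_gen B" by force+
  then have "Gcd B dvd Suc M" "Gcd B dvd Suc (Suc M)"
    by (auto intro: dvd_submonoid_gen)
  then show ?thesis by (metis Suc_eq_plus1 dvd_add_right_iff nat_dvd_1_iff_1)
qed

section \<open>Counting both families by truncated sets\<close>

text \<open>A sum below \<open>n\<close> has both summands below \<open>n\<close>, so the generator
  \<open>n\<close> is not involved and closure of \<open>T\<close> suffices.\<close>

lemma submonoid_gen_truncated:
  assumes T: "T \<in> truncated_semigroups n"
  shows "submonoid_gen (insert n T) \<inter> {..<n} = T"
proof -
  have "x < n \<longrightarrow> x \<in> T" if "x \<in> submonoid_gen (insert n T)" for x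
    using that by induction (use T in \<open>auto simp: truncated_semigroups_def\<close>)
  moreover have "T \<subseteq> {..<n}" using T by (simp add: truncated_semigroups_def)
  ultimately show ?thesis by (auto intro: submonoid_gen.incl)
qed

lemma num_frobenius_eq_card:
  assumes "n > 0"
  shows "num_frobenius n = card (truncated_semigroups n)"
proof -
  have frob: "frobenius_number S = int n \<longleftrightarrow> n \<notin> S \<and> {n<..} \<subseteq> S"
    if "numerical_semigroup S" for S
  proof -
    have fin: "finite (UNIV - S)" using that by (simp add: numerical_semigroup_def)
    show ?thesis
    proof (cases "S = UNIV")
      case False
      then have "UNIV - S \<noteq> {}" by blast
      then have "Max (UNIV - S) = n \<longleftrightarrow> n \<in> UNIV - S \<and> (\<forall>x\<in>UNIV - S. x \<le> n)"
        by (rule Max_eq_iff[OF fin])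
      also have "\<dots> \<longleftrightarrow> n \<notin> S \<and> {n<..} \<subseteq> S" by (auto simp: not_le[symmetric])
      finally show ?thesis using False by (simp add: frobenius_number_def)
    \<comment> \<open>For \<open>S = UNIV\<close> both sides fail: the default value is -1, and
      \<open>n\<close> is not a gap.\<close>
    qed (simp add: frobenius_number_def)
  qed
  have "bij_betw (\<lambda>S. S \<inter> {..<n}) {S. numerical_semigroup S \<and> frobenius_number S = int n}
          (truncated_semigroups n)"
  proof (rule bij_betw_byWitness[where f' = "\<lambda>T. T \<union> {n<..}"])
    show "\<forall>S\<in>{S. numerical_semigroup S \<and> frobenius_number S = int n}. S \<inter> {..<n} \<union> {n<..} = S"
    proof safe
      fix S x assume "numerical_semigroup S" "frobenius_number S = int n"
      then have S: "n \<notin> S" "{n<..} \<subseteq> S" using frob by auto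
      show "x \<in> S" if "n < x" using that S by auto
      show "x < n" if "x \<in> S" "\<not> n < x" using that S by (metis nat_neq_iff)
    qed
    show "\<forall>T\<in>truncated_semigroups n. (T \<union> {n<..}) \<inter> {..<n} = T"
      by (auto simp: truncated_semigroups_def)
    show "(\<lambda>S. S \<inter> {..<n}) ` {S. numerical_semigroup S \<and> frobenius_number S = int n}
            \<subseteq> truncated_semigroups n"
    proof clarify
      fix S assume ns: "numerical_semigroup S" and "frobenius_number S = int n"
      then have "n \<notin> S" using frob by auto
      \<comment> \<open>A sum equal to \<open>n\<close> is excluded because \<open>n\<close> is a
        gap; \<open>n > 0\<close> puts 0 into the trace.\<close>
      with ns assms show "S \<inter> {..<n} \<in> truncated_semigroups n"
        by (auto simp: numerical_semigroup_def truncated_semigroups_def order.order_iff_strict)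
    qed
    show "(\<lambda>T. T \<union> {n<..}) ` truncated_semigroups n
            \<subseteq> {S. numerical_semigroup S \<and> frobenius_number S = int n}"
    proof safe
      fix T assume T: "T \<in> truncated_semigroups n"
      have "UNIV - (T \<union> {n<..}) \<subseteq> {..n}" by auto
      then have "finite (UNIV - (T \<union> {n<..}))" by (rule finite_subset) simp
      with T show ns: "numerical_semigroup (T \<union> {n<..})"
        by (fastforce simp: numerical_semigroup_def truncated_semigroups_def)
      show "frobenius_number (T \<union> {n<..}) = int n"
        using T by (subst frob[OF ns]) (auto simp: truncated_semigroups_def)
    qed
  qed
  then show ?thesis unfolding num_frobenius_def by (rule bij_betw_same_card)
qed

text \<open>All primitives are at most \<open>n\<close>, so the trace below \<open>n\<close>
  together with \<open>n\<close> generates the semigroup. The gcd condition selects the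
  \<open>T\<close> for which \<open>insert n T\<close> generates a cofinite submonoid.\<close>

lemma num_max_primitive_eq_card:
  "num_max_primitive n = card {T \<in> truncated_semigroups n. Gcd (insert n T) = 1}"
proof -
  let ?A = "{S. numerical_semigroup S \<and> Max (primitives S) = n}"
  let ?B = "{T \<in> truncated_semigroups n. Gcd (insert n T) = 1}"
  have gen: "submonoid_gen (insert n (S \<inter> {..<n})) = S" if "S \<in> ?A" for S
  proof -
    have ns: "numerical_semigroup S" and m: "n \<in> primitives S" "\<forall>x\<in>primitives S. x \<le> n"
      using that Max_primitives_eq_iff by auto
    have "submonoid_gen (primitives S) = S"
      using minimal_generating_set_primitives[OF ns] by (simp add: minimal_generating_set_def)
    moreover have "x \<in> submonoid_gen (insert n (S \<inter> {..<n}))"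
      if "x \<in> submonoid_gen (primitives S)" for x
      using that
    proof induction
      case (incl x)
      then have "x \<in> insert n (S \<inter> {..<n})"
        using m primitives_eq[OF ns] by (auto simp: order.order_iff_strict)
      then show ?case by (rule submonoid_gen.incl)
    qed (auto intro: submonoid_gen.intros)
    moreover have "submonoid_gen (insert n (S \<inter> {..<n})) \<subseteq> S"
      using m primitives_eq[OF ns] by (intro submonoid_gen_subset[OF ns]) auto
    ultimately show ?thesis by blast
  qed
  have "bij_betw (\<lambda>S. S \<inter> {..<n}) ?A ?B"
  proof (rule bij_betw_byWitness[where f' = "\<lambda>T. submonoid_gen (insert n T)"])
    show "\<forall>S\<in>?A. submonoid_gen (insert n (S \<inter> {..<n})) = S"
      using gen by blast
    show "\<forall>T\<in>?B. submonoid_gen (insert n T) \<inter> {..<n} = T"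
      using submonoid_gen_truncated by blast
    show "(\<lambda>S. S \<inter> {..<n}) ` ?A \<subseteq> ?B"
    proof
      fix T assume "T \<in> (\<lambda>S. S \<inter> {..<n}) ` ?A"
      then obtain S where S: "S \<in> ?A" and T: "T = S \<inter> {..<n}" by blast
      then have ns: "numerical_semigroup S" and "n \<in> primitives S"
        using Max_primitives_eq_iff by auto
      then have n: "n \<noteq> 0" "\<And>a b. a \<in> S \<Longrightarrow> b \<in> S \<Longrightarrow> a \<noteq> 0 \<Longrightarrow> b \<noteq> 0 \<Longrightarrow> n \<noteq> a + b"
        by (auto simp: primitives_eq[OF ns])
      have "x + y \<in> T" if "x \<in> T" "y \<in> T" "x + y \<le> n" for x y
      proof -
        \<comment> \<open>If neither summand is 0, irreducibility of \<open>n\<close> applies;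
          otherwise the sum is an element of \<open>T\<close>, hence below \<open>n\<close>.\<close>
        have "x + y \<noteq> n" using n(2)[of x y] that T by (cases "x = 0"; cases "y = 0") auto
        then show ?thesis using that T ns by (auto simp: numerical_semigroup_def)
      qed
      then have "T \<in> truncated_semigroups n"
        using n T ns by (auto simp: truncated_semigroups_def numerical_semigroup_def)
      moreover have "Gcd (insert n T) = 1"
        using Gcd_generators_numerical_semigroup[of "insert n T"] gen[OF S] ns T by simp
      ultimately show "T \<in> ?B" by blast
    qed
    show "(\<lambda>T. submonoid_gen (insert n T)) ` ?B \<subseteq> ?A"
    proof clarify
      fix T assume T: "T \<in> truncated_semigroups n" and G: "Gcd (insert n T) = 1"
      let ?S = "submonoid_gen (insert n T)"
      have ns: "numerical_semigroup ?S" using G by (rule numerical_semigroup_submonoid_gen)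
      have "n \<noteq> 0" using T by (auto simp: truncated_semigroups_def)
      moreover have "n \<noteq> a + b" if "a \<in> ?S" "b \<in> ?S" "a \<noteq> 0" "b \<noteq> 0" for a b
      proof
        \<comment> \<open>Both summands are nonzero, hence below \<open>n\<close> and in
          \<open>T\<close>; closure would put \<open>n\<close> into \<open>T\<close>, a subset of
          \<open>{..<n}\<close>.\<close>
        assume ab: "n = a + b"
        then have "a \<in> ?S \<inter> {..<n}" "b \<in> ?S \<inter> {..<n}" using that by auto
        then have "a \<in> T" "b \<in> T" by (simp_all only: submonoid_gen_truncated[OF T])
        then show False using T ab by (auto simp: truncated_semigroups_def)
      qed
      ultimately have "n \<in> primitives ?S"
        by (auto simp: primitives_eq[OF ns] intro: submonoid_gen.incl)
      moreover have "x \<le> n" if "x \<in> primitives ?S" for x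
      proof -
        have "x \<in> insert n T"
          by (rule irreducible_in_generators) (use that primitives_eq[OF ns] in auto)
        then show ?thesis using T by (auto simp: truncated_semigroups_def)
      qed
      ultimately show "numerical_semigroup ?S \<and> Max (primitives ?S) = n"
        using ns Max_primitives_eq_iff by blast
    qed
  qed
  then show ?thesis unfolding num_max_primitive_def by (rule bij_betw_same_card)
qed

section \<open>Sorting by gcd\<close>

text \<open>Multiplication by \<open>d > 0\<close> is injective and respects order and sums, so
  closure transfers both ways, including the boundary case \<open>x + y = k\<close>.\<close>

lemma image_mult_truncated_semigroups_iff:
  fixes d k :: nat
  assumes "d > 0"
  shows "(*) d ` T \<in> truncated_semigroups (d * k) \<longleftrightarrow> T \<in> truncated_semigroups k"
proof -
  have "d * x + d * y \<le> d * k \<longleftrightarrow> x + y \<le> k" "d * x + d * y \<in> (*) d ` T \<longleftrightarrow> x + y \<in> T" for x y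
    using assms by (auto simp flip: distrib_left)
  then show ?thesis
    using assms by (auto simp: truncated_semigroups_def image_subset_iff)
qed

text \<open>The sets with gcd \<open>d\<close> are the dilations by \<open>d\<close> of those with
  gcd 1.\<close>

lemma card_truncated_semigroups_Gcd:
  fixes d k :: nat
  assumes "d > 0"
  shows "card {T \<in> truncated_semigroups (d * k). Gcd (insert (d * k) T) = d} =
         num_max_primitive k"
proof -
  let ?A = "{T \<in> truncated_semigroups (d * k). Gcd (insert (d * k) T) = d}"
  let ?B = "{T \<in> truncated_semigroups k. Gcd (insert k T) = 1}"
  have Gcd: "Gcd (insert (d * k) ((*) d ` T)) = d * Gcd (insert k T)" for T
    using Gcd_mult[of d "insert k T"] by simp
  have "inj ((*) d)" using assms by (simp add: inj_on_def)
  then have "inj_on ((`) ((*) d)) ?B" by (simp add: inj_on_def inj_image_eq_iff)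
  moreover have "(`) ((*) d) ` ?B = ?A"
  proof
    show "(`) ((*) d) ` ?B \<subseteq> ?A"
      using image_mult_truncated_semigroups_iff[OF assms] Gcd by auto
    show "?A \<subseteq> (`) ((*) d) ` ?B"
    proof
      fix T assume T: "T \<in> ?A"
      have "d dvd x" if "x \<in> T" for x
        using Gcd_dvd[of x "insert (d * k) T"] T that by simp
      then have "T \<subseteq> range ((*) d)" by (auto simp: dvd_def)
      then obtain U where U: "T = (*) d ` U" using subset_imageE by metis
      \<comment> \<open>Cancel \<open>d\<close> in \<open>d = d * Gcd (insert k U)\<close>.\<close>
      then have "Gcd (insert k U) = 1"
        using T Gcd[of U] assms by (simp del: Gcd_insert)
      then have "U \<in> ?B"
        using T U image_mult_truncated_semigroups_iff[OF assms] by blast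
      with U show "T \<in> (`) ((*) d) ` ?B" by blast
    qed
  qed
  ultimately have "card ?A = card ?B" using card_image by fastforce
  then show ?thesis by (simp add: num_max_primitive_eq_card)
qed

lemma num_frobenius_eq_sum:
  assumes "n > 0"
  shows "num_frobenius n = (\<Sum>d | d dvd n. num_max_primitive (n div d))"
proof -
  have "num_frobenius n = card (truncated_semigroups n)"
    using assms by (rule num_frobenius_eq_card)
  also have "\<dots> = (\<Sum>d | d dvd n. card {T \<in> truncated_semigroups n. Gcd (insert n T) = d})"
  proof -
    \<comment> \<open>The gcd divides \<open>n\<close> because \<open>n\<close> belongs to
      \<open>insert n T\<close>, so each \<open>T\<close> falls into one of the classes.\<close>
    have "truncated_semigroups n =
        (\<Union>d\<in>{d. d dvd n}. {T \<in> truncated_semigroups n. Gcd (insert n T) = d})"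
      by (auto simp del: Gcd_insert intro: Gcd_dvd)
    also have "card \<dots> = (\<Sum>d | d dvd n. card {T \<in> truncated_semigroups n. Gcd (insert n T) = d})"
      using assms finite_truncated_semigroups by (intro card_UN_disjoint) auto
    finally show ?thesis .
  qed
  also have "\<dots> = (\<Sum>d | d dvd n. num_max_primitive (n div d))"
  proof (rule sum.cong)
    fix d assume "d \<in> {d. d dvd n}"
    then obtain k where "n = d * k" by auto
    with assms show "card {T \<in> truncated_semigroups n. Gcd (insert n T) = d} =
        num_max_primitive (n div d)"
      using card_truncated_semigroups_Gcd[of d k] by simp
  qed simp
  finally show ?thesis .
qed

text \<open>Supplies the term of the divisor \<open>p\<close> in the sum for a prime
  \<open>p\<close>.\<close>

lemma num_max_primitive_1: "num_max_primitive 1 = 1"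
proof -
  have "{T \<in> truncated_semigroups 1. Gcd (insert 1 T) = 1} = {{0}}"
    by (auto simp: truncated_semigroups_def)
  then show ?thesis by (simp add: num_max_primitive_eq_card)
qed

theorem theorem1p1:
  shows "(\<forall>n::nat. n > 0 \<longrightarrow>
            num_frobenius n = (\<Sum>d | d dvd n. num_max_primitive (n div d))) \<and>
         (\<forall>p::nat. prime p \<longrightarrow> num_frobenius p = num_max_primitive p + 1)"
proof (intro conjI allI impI)
  fix p :: nat assume p: "prime p"
  then have "{d. d dvd p} = {1, p}" by (auto simp: prime_nat_iff)
  \<comment> \<open>This keeps the divisors 1 and \<open>p\<close> distinct, so the sum has two
    terms.\<close>
  moreover have "p > 1" using p by (rule prime_gt_1_nat)
  ultimately show "num_frobenius p = num_max_primitive p + 1"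
    using num_max_primitive_1 by (simp add: num_frobenius_eq_sum)
qed (rule num_frobenius_eq_sum)

end
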